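(* Let $p=1/2$. Assume that, for any $\lambda\le 2$, the expected value of a $(1/2,\lambda)$-random Fibonacci sequence increases exponentially fast, with growth rate equal to $\mathcal{G}(\lambda)$. If $\mathcal{G}$ is differentiable at $\lambda=2$, then $\mathcal{G}'(2)=1$. If $\mathcal{G}$ is of class $C^n$ at $\lambda=2$, then $\mathcal{G}^{(i)}(2)=0$ for any $i\in[2,n]$. As a corollary, $\mathcal{G}$ cannot be analytic at $\lambda=2$.
   Context: For $p\in[0,1]$ and a real number $\lambda$, a $(p,\lambda)$-random Fibonacci sequence is a random sequence $(g_n)_{n\ge1}$ whose first two terms $g_1,g_2$ are fixed positive real numbers and which satisfies, for $n\ge3$, $g_n=|\lambda g_{n-1}\pm g_{n-2}|$, where for each $n$ the $\pm$ sign is chosen by an independent coin toss: $+$ with probability $p$ and $-$ with probability $1-p$. The growth rate of the expected value is the limit of $(\mathbb{E}(g_n))^{1/n}$ as $n\to\infty$; the expected value increases exponentially fast when this limit is greater than $1$. *)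

theory Defs
  imports "HOL-Probability.Probability"
begin

(* Terms are indexed from 1; the value of g 0 is irrelevant. The event "coin n = True" is the
   choice of the sign + in the recurrence for the n-th term. *)
definition random_fibonacci ::
    "'a measure \<Rightarrow> real \<Rightarrow> real \<Rightarrow> (nat \<Rightarrow> 'a \<Rightarrow> real) \<Rightarrow> bool" where
  "random_fibonacci M p l g \<longleftrightarrow>
     prob_space M \<and>
     (\<exists>x>0. \<forall>\<omega>\<in>space M. g 1 \<omega> = x) \<and>
     (\<exists>y>0. \<forall>\<omega>\<in>space M. g 2 \<omega> = y) \<and>
     (\<exists>coin :: nat \<Rightarrow> 'a \<Rightarrow> bool.
        prob_space.indep_vars M (\<lambda>_. count_space UNIV) coin {3..} \<and>
        (\<forall>n\<ge>3. measure M {\<omega> \<in> space M. coin n \<omega>} = p) \<and>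
        (\<forall>n\<ge>3. \<forall>\<omega>\<in>space M.
           g n \<omega> = (if coin n \<omega> then \<bar>l * g (n - 1) \<omega> + g (n - 2) \<omega>\<bar>
                            else \<bar>l * g (n - 1) \<omega> - g (n - 2) \<omega>\<bar>)))"

definition expectation_growth_rate ::
    "'a measure \<Rightarrow> (nat \<Rightarrow> 'a \<Rightarrow> real) \<Rightarrow> real \<Rightarrow> bool" where
  "expectation_growth_rate M g r \<longleftrightarrow>
     (\<lambda>n. root n (prob_space.expectation M (g n))) \<longlonglongrightarrow> r"

(* Derivatives, C^n regularity and analyticity of a function f of a real variable, regarded as
   a function on the set S only; at an endpoint of an interval S they are one-sided. The library
   notion analytic_on is not usable here: on the reals it amounts to differentiability. *)

primrec nth_deriv_within :: "real set \<Rightarrow> nat \<Rightarrow> (real \<Rightarrow> real) \<Rightarrow> real \<Rightarrow> real" where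
  "nth_deriv_within S 0 f = f"
| "nth_deriv_within S (Suc n) f =
     (\<lambda>x. vector_derivative (nth_deriv_within S n f) (at x within S))"

definition class_C_at_within :: "nat \<Rightarrow> (real \<Rightarrow> real) \<Rightarrow> real \<Rightarrow> real set \<Rightarrow> bool" where
  "class_C_at_within n f x S \<longleftrightarrow>
     (\<exists>e>0. (\<forall>i<n. \<forall>y\<in>S \<inter> ball x e. nth_deriv_within S i f differentiable (at y within S)) \<and>
            continuous_on (S \<inter> ball x e) (nth_deriv_within S n f))"

definition real_analytic_at_within :: "(real \<Rightarrow> real) \<Rightarrow> real \<Rightarrow> real set \<Rightarrow> bool" where
  "real_analytic_at_within f x S \<longleftrightarrow>
     (\<exists>c :: nat \<Rightarrow> real. \<exists>e>0. \<forall>y\<in>S \<inter> ball x e. (\<lambda>i. c i * (y - x) ^ i) sums f y)"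

end

theory Submission
  imports Defs "HOL-Real_Asymp.Real_Asymp"
begin

text \<open>
  Since the mean of \<open>\<bar>l u + v\<bar>\<close> and \<open>\<bar>l u - v\<bar>\<close> is \<open>max (l u) v\<close>, we have
  \<open>E g\<^sub>n\<^sub>+\<^sub>2 = l E g\<^sub>n\<^sub>+\<^sub>1 + E (g\<^sub>n - l g\<^sub>n\<^sub>+\<^sub>1)\<^sup>+\<close>. For \<open>l\<close> just below 2 the positive part can be
  nonzero only after about \<open>1 / sqrt (2 - l)\<close> consecutive minus signs: a plus sign makes the ratio of
  consecutive terms at least \<open>l\<close>, and each minus sign lowers it only slightly. As a minus sign
  at most doubles the terms and has probability 1/2, the positive part contributes at most
  \<open>2 / l ^ k\<close> to the growth rate, with \<open>k\<close> of order \<open>1 / sqrt (2 - l)\<close>. So \<open>G l - l\<close> is flat at 2. On the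
  other hand \<open>l = 2 cos \<theta>\<close> with \<open>\<theta> > 0\<close>, so a run of minus signs acts as a rotation, which
  must leave the positive quadrant; this makes the contribution strictly positive. Hence
  \<open>G\<close> has the Taylor coefficients of the identity at 2 without coinciding with it.
\<close>

section \<open>Growth rates\<close>

lemma root_geometric_tendsto:
  fixes c r :: real
  assumes "c > 0" "r > 0" "K > 0"
  shows "(\<lambda>q. root (m + K * q) (c * r ^ q)) \<longlonglongrightarrow> root K r"
proof -
  have "(\<lambda>q::nat. exp ((ln c + q * ln r) / (m + K * q))) \<longlonglongrightarrow> exp (ln r * inverse (real K))"
    using assms by real_asymp
  moreover have "exp (ln r * inverse (real K)) = root K r"
    using assms by (simp add: root_powr_inverse powr_def inverse_eq_divide)
  \<comment> \<open>The index \<open>q = 0\<close> is left out because for \<open>m = 0\<close> it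
    would give \<open>root 0\<close>, whose value is 0.\<close>
  moreover have "\<forall>\<^sub>F q in sequentially. exp ((ln c + q * ln r) / (m + K * q)) = root (m + K * q) (c * r ^ q)"
    using eventually_gt_at_top[of 0]
    by eventually_elim (use assms in \<open>simp add: root_powr_inverse powr_def ln_mult ln_realpow field_simps\<close>)
  ultimately show ?thesis
    using tendsto_cong by fastforce
qed

text \<open>Iterating the step bounds \<open>e\<close> below by a geometric sequence along the
  indices \<open>m + K * q\<close>. As the roots are assumed to converge, this subsequence
  determines \<open>G\<close>, so a gain measured over \<open>K\<close> steps suffices.\<close>

lemma growth_rate_ge:
  fixes e :: "nat \<Rightarrow> real"
  assumes lim: "(\<lambda>n. root n (e n)) \<longlonglongrightarrow> G" and "r > 0" "K > 0" "e m > 0"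
    and step: "\<And>n. n \<ge> m \<Longrightarrow> r * e n \<le> e (n + K)"
  shows "root K r \<le> G"
proof (rule LIMSEQ_le)
  show "(\<lambda>q. root (m + K * q) (e m * r ^ q)) \<longlonglongrightarrow> root K r"
    using root_geometric_tendsto assms by blast
  have "strict_mono (\<lambda>q. m + K * q)"
    using \<open>K > 0\<close> by (simp add: strict_mono_def)
  from LIMSEQ_subseq_LIMSEQ[OF lim this]
  show "(\<lambda>q. root (m + K * q) (e (m + K * q))) \<longlonglongrightarrow> G"
    by (simp add: o_def)
  have "e m * r ^ q \<le> e (m + K * q)" for q
  proof (induction q)
    case (Suc q)
    have "e m * r ^ Suc q \<le> r * e (m + K * q)"
      using Suc \<open>r > 0\<close> by (simp add: mult.left_commute)
    also have "\<dots> \<le> e (m + K * q + K)"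
      by (rule step) simp
    finally show ?case
      by (simp add: add.commute add.left_commute)
  qed simp
  moreover have "0 < m + K * q" if "q \<ge> 1" for q
    using that \<open>K > 0\<close> by simp
  ultimately show "\<exists>N. \<forall>q\<ge>N. root (m + K * q) (e m * r ^ q) \<le> root (m + K * q) (e (m + K * q))"
    by (intro exI[of _ 1]) (auto intro!: real_root_le_mono)
qed

lemma growth_rate_le:
  fixes e :: "nat \<Rightarrow> real"
  assumes lim: "(\<lambda>n. root n (e n)) \<longlonglongrightarrow> G" and "r > 0" "e m > 0"
    and step: "\<And>n. n \<ge> m \<Longrightarrow> e (Suc n) \<le> r * e n"
  shows "G \<le> r"
proof (rule LIMSEQ_le)
  show "(\<lambda>q. root (m + 1 * q) (e m * r ^ q)) \<longlonglongrightarrow> r"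
    using root_geometric_tendsto[of "e m" r 1 m] assms by simp
  show "(\<lambda>q. root (m + q) (e (m + q))) \<longlonglongrightarrow> G"
    using LIMSEQ_ignore_initial_segment[OF lim, of m] by (simp add: add.commute)
  have "e (m + q) \<le> e m * r ^ q" for q
  proof (induction q)
    case (Suc q)
    have "e (m + Suc q) \<le> r * e (m + q)"
      using step[of "m + q"] by simp
    also have "\<dots> \<le> e m * r ^ Suc q"
      using Suc \<open>r > 0\<close> by (simp add: mult.left_commute)
    finally show ?case .
  qed simp
  then show "\<exists>N. \<forall>q\<ge>N. root (m + q) (e (m + q)) \<le> root (m + 1 * q) (e m * r ^ q)"
    by (intro exI[of _ 1]) (auto intro!: real_root_le_mono)
qed

section \<open>Flat functions\<close>

text \<open>
  If the derivatives of order below \<open>i\<close> vanish at \<open>a\<close>, iterating l'Hospital's rule shows that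
  \<open>f 0 y / (y - a) ^ i\<close> tends to \<open>f i a / fact i\<close>.
\<close>

lemma flat_imp_derivatives_zero:
  fixes f :: "nat \<Rightarrow> real \<Rightarrow> real"
  assumes deriv: "\<And>i. i < n \<Longrightarrow> \<forall>\<^sub>F y in at_left a. (f i has_real_derivative f (Suc i) y) (at y)"
    and cont: "\<And>i. i \<le> n \<Longrightarrow> (f i \<longlongrightarrow> f i a) (at_left a)"
    and flat: "\<And>i. i \<le> n \<Longrightarrow> ((\<lambda>y. f 0 y / (y - a) ^ i) \<longlongrightarrow> 0) (at_left a)"
    and "i \<le> n"
  shows "f i a = 0"
  using \<open>i \<le> n\<close>
proof (induction i rule: less_induct)
  case (less i)
  have "((\<lambda>y. f (i - j) y / (y - a) ^ j) \<longlongrightarrow> f i a / fact j) (at_left a)" if "j \<le> i" for j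
    using that
  proof (induction j)
    case 0
    then show ?case
      using cont[of i] less.prems by simp
  next
    case (Suc j)
    let ?k = "i - Suc j"
    have k: "Suc ?k = i - j" "?k < i" "?k < n"
      using Suc.prems less.prems by auto
    show ?case
    proof (rule lhopital_left)
      show "(f ?k \<longlongrightarrow> 0) (at_left a)"
        using cont[of ?k] less.IH[of ?k] k by simp
      show "((\<lambda>y. (y - a) ^ Suc j) \<longlongrightarrow> 0) (at_left a)"
        by (auto intro!: tendsto_eq_intros)
      show "\<forall>\<^sub>F y in at_left a. (y - a) ^ Suc j \<noteq> 0"
        by (auto simp: eventually_at_filter)
      show "\<forall>\<^sub>F y in at_left a. real (Suc j) * (y - a) ^ j \<noteq> 0"
        unfolding eventually_at_filter by auto
      show "\<forall>\<^sub>F y in at_left a. (f ?k has_real_derivative f (i - j) y) (at y)"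
        using deriv[of ?k] k by simp
      show "\<forall>\<^sub>F y in at_left a.
          ((\<lambda>y. (y - a) ^ Suc j) has_real_derivative real (Suc j) * (y - a) ^ j) (at y)"
        by (intro always_eventually allI) (auto intro!: derivative_eq_intros simp del: power_Suc)
      have "((\<lambda>y. f (i - j) y / (y - a) ^ j / real (Suc j)) \<longlongrightarrow> f i a / fact j / real (Suc j)) (at_left a)"
        using Suc by (intro tendsto_divide[OF _ tendsto_const]) auto
      then show "((\<lambda>y. f (i - j) y / (real (Suc j) * (y - a) ^ j)) \<longlongrightarrow> f i a / fact (Suc j)) (at_left a)"
        by (simp add: divide_divide_eq_left mult.commute)
    qed
  qed
  from this[of i] have "((\<lambda>y. f 0 y / (y - a) ^ i) \<longlongrightarrow> f i a / fact i) (at_left a)"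
    by simp
  from tendsto_unique[OF _ this flat[OF less.prems]] show ?case
    by simp
qed

text \<open>Once the lower coefficients vanish, dividing by \<open>(y - a) ^ i\<close> leaves a
  power series with constant term \<open>d i\<close>. Its sum is continuous at \<open>a\<close>, so
  its left limit there is \<open>d i\<close>, and by flatness it is 0.\<close>

lemma flat_power_series_zero:
  fixes d :: "nat \<Rightarrow> real"
  assumes "e > 0" and sums: "\<And>y. a - e < y \<Longrightarrow> y < a \<Longrightarrow> (\<lambda>i. d i * (y - a) ^ i) sums f y"
    and flat: "\<And>i. ((\<lambda>y. f y / (y - a) ^ i) \<longlongrightarrow> 0) (at_left a)"
  shows "d i = 0"
proof (induction i rule: less_induct)
  case (less i)
  define h where "h z = (\<Sum>j. d (j + i) * z ^ j)" for z
  \<comment> \<open>The expansion is known only to the left of \<open>a\<close>; convergence at the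
    single offset \<open>- (e/2)\<close> gives it for all smaller offsets of either sign.\<close>
  have "summable (\<lambda>j. d j * (- (e/2)) ^ j)"
    using sums[of "a - e/2"] \<open>e > 0\<close> by (simp add: sums_iff)
  then have "summable (\<lambda>j. d (j + i) * (- (e/2)) ^ (j + i))"
    by (rule summable_ignore_initial_segment)
  then have "summable (\<lambda>j. (- (e/2)) ^ i * (d (j + i) * (- (e/2)) ^ j))"
    by (simp add: power_add mult_ac)
  then have summ: "summable (\<lambda>j. d (j + i) * (- (e/2)) ^ j)"
    using \<open>e > 0\<close> by (subst (asm) summable_cmult_iff) auto
  have "(h \<longlongrightarrow> d (0 + i)) (at 0)"
  proof (rule powser_limit_0_strong[where s = "e/2"])
    show "(\<lambda>j. d (j + i) * z ^ j) sums h z" if "z \<noteq> 0" "norm z < e/2" for z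
      unfolding h_def using powser_inside[OF summ, of z] that by (simp add: summable_sums)
  qed (use \<open>e > 0\<close> in auto)
  then have "((\<lambda>y. h (y - a)) \<longlongrightarrow> d i) (at a)"
    using LIM_offset_zero_cancel[of "\<lambda>y. h (y - a)" a "d i"] by simp
  then have lim: "((\<lambda>y. h (y - a)) \<longlongrightarrow> d i) (at_left a)"
    by (rule tendsto_within_subset) simp
  have "h (y - a) = f y / (y - a) ^ i" if "a - e < y" "y < a" for y
  proof -
    have "(\<lambda>j. d (j + i) * (y - a) ^ (j + i)) sums f y"
      using sums_iff_shift[of "\<lambda>j. d j * (y - a) ^ j" i "f y"] sums[OF that] less.IH by simp
    then have "(\<lambda>j. d (j + i) * (y - a) ^ (j + i) / (y - a) ^ i) sums (f y / (y - a) ^ i)"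
      by (rule sums_divide)
    moreover have "d (j + i) * (y - a) ^ (j + i) / (y - a) ^ i = d (j + i) * (y - a) ^ j" for j
      using that by (simp add: power_add)
    ultimately show ?thesis
      by (simp add: h_def sums_iff)
  qed
  then have "\<forall>\<^sub>F y in at_left a. h (y - a) = f y / (y - a) ^ i"
    using \<open>e > 0\<close> by (auto simp: eventually_at_left_field intro!: exI[of _ "a - e"])
  then have "((\<lambda>y. f y / (y - a) ^ i) \<longlongrightarrow> d i) (at_left a)"
    using lim tendsto_cong by fastforce
  from tendsto_unique[OF _ this flat] show ?case
    by simp
qed

lemma at_within_atMost_eq_at_left: "at (x::real) within {..x} = at_left x"
  by (rule at_within_nhd[of x UNIV]) auto

text \<open>The flat function is \<open>G\<close> minus the identity, so
  \<open>flat_imp_derivatives_zero\<close> is applied to that difference; from order 2 on the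
  identity contributes nothing.\<close>

lemma nth_deriv_flat_zero:
  fixes G :: "real \<Rightarrow> real"
  assumes flat: "\<And>i. ((\<lambda>y. (G y - y) / (y - x) ^ i) \<longlongrightarrow> 0) (at_left x)"
    and C: "class_C_at_within n G x {..x}" and i: "2 \<le> i" "i \<le> n"
  shows "nth_deriv_within {..x} i G x = 0"
proof -
  define f where "f i = nth_deriv_within {..x} i G" for i
  \<comment> \<open>The \<open>i\<close>-th derivative of the identity.\<close>
  define p where "p i y = (if i = 0 then y else if i = 1 then 1 else 0 :: real)" for i :: nat and y :: real
  obtain e where e: "0 < e" and diff: "\<And>i y. i < n \<Longrightarrow> y \<le> x \<Longrightarrow> y \<in> ball x e \<Longrightarrow> f i differentiable (at y within {..x})"
    and cont: "continuous_on ({..x} \<inter> ball x e) (f n)"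
    using C unfolding class_C_at_within_def f_def by auto
  have "f i x - p i x = 0"
  proof (rule flat_imp_derivatives_zero[where f = "\<lambda>i y. f i y - p i y" and n = n])
    fix i
    assume "i < n"
    have "\<forall>\<^sub>F y in at_left x. y \<in> {x - e<..<x}"
      using e by (intro eventually_at_leftI[of "x - e"]) auto
    then show "\<forall>\<^sub>F y in at_left x. ((\<lambda>y. f i y - p i y) has_real_derivative f (Suc i) y - p (Suc i) y) (at y)"
    proof eventually_elim
      fix y
      assume y: "y \<in> {x - e<..<x}"
      \<comment> \<open>Points strictly left of \<open>x\<close> are interior to
        \<open>{..x}\<close>, so the derivative within the set is the ordinary one.\<close>
      have "at y within {..x} = at y"
        using y by (intro at_within_nhd[of y "{..<x}"]) auto
      moreover have "(f i has_vector_derivative f (Suc i) y) (at y within {..x})"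
        using diff[OF \<open>i < n\<close>, of y] y
        by (simp add: vector_derivative_works f_def dist_real_def)
      ultimately have "(f i has_real_derivative f (Suc i) y) (at y)"
        by (simp add: has_real_derivative_iff_has_vector_derivative)
      moreover have "(p i has_real_derivative p (Suc i) y) (at y)"
        by (auto simp: p_def[abs_def])
      ultimately show "((\<lambda>y. f i y - p i y) has_real_derivative f (Suc i) y - p (Suc i) y) (at y)"
        by (rule DERIV_diff)
    qed
  next
    fix i
    assume "i \<le> n"
    have "(f i \<longlongrightarrow> f i x) (at x within {..x})"
    \<comment> \<open>The top derivative is continuous by the definition of the class, the lower
      ones because they are differentiable at \<open>x\<close>.\<close>
    proof (cases "i = n")
      case True
      have "at x within {..x} \<inter> ball x e = at x within {..x}"
        using e by (intro at_within_nhd[of x "ball x e"]) auto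
      then show ?thesis
        using cont e True by (metis IntI atMost_iff centre_in_ball continuous_on_def order_refl)
    next
      case False
      then have "continuous (at x within {..x}) (f i)"
        using diff[of i x] e \<open>i \<le> n\<close> by (intro differentiable_imp_continuous_within) auto
      then show ?thesis
        by (simp add: continuous_within)
    qed
    then have "(f i \<longlongrightarrow> f i x) (at_left x)"
      by (simp add: at_within_atMost_eq_at_left)
    moreover have "(p i \<longlongrightarrow> p i x) (at_left x)"
      by (auto simp: p_def[abs_def])
    ultimately show "((\<lambda>y. f i y - p i y) \<longlongrightarrow> f i x - p i x) (at_left x)"
      by (rule tendsto_diff)
  next
    show "((\<lambda>y. (f 0 y - p 0 y) / (y - x) ^ i) \<longlongrightarrow> 0) (at_left x)" for i
      using flat[of i] by (simp add: f_def p_def)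
  qed (rule i)
  then show ?thesis
    using i by (simp add: f_def p_def)
qed

lemma flat_analytic_eq:
  fixes G :: "real \<Rightarrow> real"
  assumes flat: "\<And>i. ((\<lambda>y. (G y - y) / (y - x) ^ i) \<longlongrightarrow> 0) (at_left x)"
    and ana: "real_analytic_at_within G x {..x}"
  shows "\<forall>\<^sub>F y in at_left x. G y = y"
proof -
  obtain c e where e: "0 < e" and c: "\<And>y. y \<le> x \<Longrightarrow> y \<in> ball x e \<Longrightarrow> (\<lambda>i. c i * (y - x) ^ i) sums G y"
    using ana unfolding real_analytic_at_within_def by blast
  \<comment> \<open>Coefficients of the identity expanded about \<open>x\<close>, that is of
    \<open>x + (y - x)\<close>.\<close>
  define q where "q i = (if i = 0 then x else if i = 1 then 1 else 0)" for i :: nat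
  have q: "(\<lambda>i. q i * (y - x) ^ i) sums y" for y
  proof -
    have "(\<lambda>i. q i * (y - x) ^ i) sums (\<Sum>i\<in>{0, 1}. q i * (y - x) ^ i)"
      by (rule sums_finite) (auto simp: q_def)
    then show ?thesis
      by (simp add: q_def)
  qed
  have sums: "(\<lambda>i. (c i - q i) * (y - x) ^ i) sums (G y - y)" if "x - e < y" "y < x" for y
    using sums_diff[OF c q, of y] that by (simp add: dist_real_def left_diff_distrib)
  from flat_power_series_zero[OF e this flat] have "c i - q i = 0" for i .
  then have "G y - y = 0" if "x - e < y" "y < x" for y
    using sums_unique2[OF sums[OF that], of 0] \<open>\<And>i. c i - q i = 0\<close> by simp
  then show ?thesis
    using e by (intro eventually_at_leftI[of "x - e"]) auto
qed

section \<open>Independence of disjoint blocks of coins\<close>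

context prob_space
begin

lemma prob_coin_block:
  fixes coin :: "nat \<Rightarrow> 'a \<Rightarrow> bool"
  assumes indep: "indep_vars (\<lambda>_. count_space UNIV) coin I"
    and B: "finite B" "B \<subseteq> I"
    and q: "\<And>i. i \<in> B \<Longrightarrow> prob {\<omega> \<in> space M. \<not> coin i \<omega>} = q"
  shows "prob {\<omega> \<in> space M. \<forall>i\<in>B. \<not> coin i \<omega>} = q ^ card B"
proof (cases "B = {}")
  case True
  then show ?thesis
    by (simp add: prob_space)
next
  case False
  have "(\<Inter>i\<in>B. coin i -` {False} \<inter> space M) = {\<omega> \<in> space M. \<forall>i\<in>B. \<not> coin i \<omega>}"
    using False by auto
  moreover have "coin i -` {False} \<inter> space M = {\<omega> \<in> space M. \<not> coin i \<omega>}" for i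
    by auto
  ultimately show ?thesis
    using indep_varsD[OF indep False B, of "\<lambda>_. {False}"] q by simp
qed

text \<open>Coins over disjoint index sets form independent families, so the indicator of an
  all-minus block and a function of the other coins multiply in expectation. Writing the latter
  through \<open>restrict\<close> makes it visibly a function of the coins in \<open>A\<close>
  alone.\<close>

lemma expectation_coin_block:
  fixes coin :: "nat \<Rightarrow> 'a \<Rightarrow> bool" and \<phi> :: "(nat \<Rightarrow> bool) \<Rightarrow> real"
  assumes indep: "indep_vars (\<lambda>_. count_space UNIV) coin I"
    and A: "A \<subseteq> I" "A \<inter> B = {}" and B: "finite B" "B \<subseteq> I"
    and q: "\<And>i. i \<in> B \<Longrightarrow> prob {\<omega> \<in> space M. \<not> coin i \<omega>} = q"
    and \<phi>: "\<phi> \<in> borel_measurable (PiM A (\<lambda>_. count_space UNIV))"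
    and int: "integrable M (\<lambda>\<omega>. \<phi> (restrict (\<lambda>i. coin i \<omega>) A))"
  shows "expectation (\<lambda>\<omega>. of_bool (\<forall>i\<in>B. \<not> coin i \<omega>) * \<phi> (restrict (\<lambda>i. coin i \<omega>) A)) =
    q ^ card B * expectation (\<lambda>\<omega>. \<phi> (restrict (\<lambda>i. coin i \<omega>) A))"
proof -
  let ?N = "\<lambda>_. count_space UNIV :: bool measure"
  define X where "X \<omega> = (of_bool (\<forall>i\<in>B. \<not> coin i \<omega>) :: real)" for \<omega>
  have "(\<lambda>c. of_bool (\<forall>i\<in>B. c i = False)) \<in> borel_measurable (PiM B ?N)"
    using B by measurable
  from indep_var_compose[OF indep_var_restrict[OF indep _ B(2) A(1)] this \<phi>]
  have ind: "indep_var borel X borel (\<lambda>\<omega>. \<phi> (restrict (\<lambda>i. coin i \<omega>) A))"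
    using A(2) by (simp add: o_def X_def[abs_def] Int_commute cong: ball_cong)
  have "integrable M X"
    by (rule integrable_const_bound[where B = 1]) (use ind indep_var_rv1 in \<open>auto simp: X_def\<close>)
  then have "expectation (\<lambda>\<omega>. X \<omega> * \<phi> (restrict (\<lambda>i. coin i \<omega>) A)) =
      expectation X * expectation (\<lambda>\<omega>. \<phi> (restrict (\<lambda>i. coin i \<omega>) A))"
    using indep_var_lebesgue_integral[OF ind _ int] by simp
  also have "expectation X = expectation (indicator {\<omega> \<in> space M. \<forall>i\<in>B. \<not> coin i \<omega>})"
    by (rule Bochner_Integration.integral_cong) (auto simp: indicator_def X_def)
  also have "\<dots> = prob ({\<omega> \<in> space M. \<forall>i\<in>B. \<not> coin i \<omega>} \<inter> space M)"
    by simp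
  also have "{\<omega> \<in> space M. \<forall>i\<in>B. \<not> coin i \<omega>} \<inter> space M = {\<omega> \<in> space M. \<forall>i\<in>B. \<not> coin i \<omega>}"
    by auto
  also have "prob \<dots> = q ^ card B"
    using prob_coin_block[OF indep B q] .
  finally show ?thesis
    unfolding X_def .
qed

end

section \<open>Random Fibonacci sequences with fair coins\<close>

text \<open>
  The sequence as an explicit function of the signs, so that independence of the coins applies to it;
  the value at index 0 is junk.
\<close>

fun fib_path :: "real \<Rightarrow> real \<Rightarrow> real \<Rightarrow> (nat \<Rightarrow> bool) \<Rightarrow> nat \<Rightarrow> real" where
  "fib_path l x y c 0 = x"
| "fib_path l x y c (Suc 0) = x"
| "fib_path l x y c (Suc (Suc 0)) = y"
| "fib_path l x y c (Suc (Suc (Suc n))) =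
     \<bar>l * fib_path l x y c (Suc (Suc n)) +
        (if c (Suc (Suc (Suc n))) then 1 else - 1) * fib_path l x y c (Suc n)\<bar>"

lemma fib_path_restrict:
  "n \<le> m \<Longrightarrow> fib_path l x y (restrict c {3..m}) n = fib_path l x y c n"
  by (induction l x y c n rule: fib_path.induct) auto

lemma fib_path_measurable:
  "n \<le> m \<Longrightarrow> (\<lambda>c. fib_path l x y c n) \<in> borel_measurable (PiM {3..m} (\<lambda>_. count_space UNIV))"
proof (induction n rule: less_induct)
  case (less n)
  consider "n = 0" | "n = 1" | "n = 2" | k where "n = Suc (Suc (Suc k))"
    by (metis One_nat_def Suc_1 not0_implies_Suc)
  then show ?case
  proof cases
    case (4 k)
    have [measurable]: "(\<lambda>c. fib_path l x y c (Suc (Suc k))) \<in> borel_measurable (PiM {3..m} (\<lambda>_. count_space UNIV))"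
      "(\<lambda>c. fib_path l x y c (Suc k)) \<in> borel_measurable (PiM {3..m} (\<lambda>_. count_space UNIV))"
      using less 4 by auto
    have [measurable]: "(\<lambda>c. c (Suc (Suc (Suc k)))) \<in> measurable (PiM {3..m} (\<lambda>_. count_space UNIV)) (count_space UNIV)"
      using less.prems 4 by (intro measurable_component_singleton) auto
    show ?thesis
      unfolding 4 fib_path.simps by measurable
  qed (simp_all add: numeral_2_eq_2)
qed

text \<open>Fixes the witnesses of the existential quantifiers in \<open>random_fibonacci\<close>.
  The bound \<open>1 \<le> l\<close> makes the expected values nondecreasing from index 2
  on.\<close>

locale fair_random_fibonacci = prob_space M for M :: "'a measure" +
  fixes l :: real and g :: "nat \<Rightarrow> 'a \<Rightarrow> real" and coin :: "nat \<Rightarrow> 'a \<Rightarrow> bool" and x y :: real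
  assumes l: "1 \<le> l" "l \<le> 2" and pos: "0 < x" "0 < y"
    and g_1: "\<omega> \<in> space M \<Longrightarrow> g 1 \<omega> = x"
    and g_2: "\<omega> \<in> space M \<Longrightarrow> g 2 \<omega> = y"
    and indep: "indep_vars (\<lambda>_. count_space UNIV) coin {3..}"
    and fair: "3 \<le> n \<Longrightarrow> prob {\<omega> \<in> space M. coin n \<omega>} = 1 / 2"
    and rec: "3 \<le> n \<Longrightarrow> \<omega> \<in> space M \<Longrightarrow>
      g n \<omega> = (if coin n \<omega> then \<bar>l * g (n - 1) \<omega> + g (n - 2) \<omega>\<bar>
                       else \<bar>l * g (n - 1) \<omega> - g (n - 2) \<omega>\<bar>)"
begin

text \<open>Indicator that the \<open>k\<close> coins producing \<open>g (n + 2)\<close>, ...,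
  \<open>g (n + 1 + k)\<close> are all minus. The pair \<open>g n\<close>, \<open>g (n + 1)\<close>
  depends on earlier coins only.\<close>

definition minus_block :: "nat \<Rightarrow> nat \<Rightarrow> 'a \<Rightarrow> real" where
  "minus_block n k \<omega> = of_bool (\<forall>i\<in>{n + 2..n + 1 + k}. \<not> coin i \<omega>)"

lemma coin_measurable [measurable]: "3 \<le> i \<Longrightarrow> coin i \<in> measurable M (count_space UNIV)"
  using indep by (auto simp: indep_vars_def)

lemma g_eq_fib_path: "\<omega> \<in> space M \<Longrightarrow> 1 \<le> n \<Longrightarrow> g n \<omega> = fib_path l x y (\<lambda>i. coin i \<omega>) n"
proof (induction n rule: less_induct)
  case (less n)
  consider "n = 1" | "n = 2" | k where "n = Suc (Suc (Suc k))"
    using less.prems by (metis One_nat_def Suc_1 not0_implies_Suc not_one_le_zero)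
  then show ?case
  proof cases
    case (3 k)
    then show ?thesis
      using less.IH[of "Suc k"] less.IH[of "Suc (Suc k)"] less.prems rec[of n \<omega>] by simp
  qed (use less.prems g_1 g_2 in \<open>simp_all add: numeral_2_eq_2\<close>)
qed

lemma g_nonneg: "\<omega> \<in> space M \<Longrightarrow> 1 \<le> n \<Longrightarrow> 0 \<le> g n \<omega>"
  using rec[of n \<omega>] g_1[of \<omega>] g_2[of \<omega>] pos
  by (cases "n = 1"; cases "n = 2") auto

lemma g_plus: "\<omega> \<in> space M \<Longrightarrow> 1 \<le> n \<Longrightarrow> coin (n + 2) \<omega> \<Longrightarrow> g (n + 2) \<omega> = l * g (n + 1) \<omega> + g n \<omega>"
  using rec[of "n + 2" \<omega>] g_nonneg[of \<omega> "n + 1"] g_nonneg[of \<omega> n] l by simp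

lemma g_minus: "\<omega> \<in> space M \<Longrightarrow> 1 \<le> n \<Longrightarrow> \<not> coin (n + 2) \<omega> \<Longrightarrow> g (n + 2) \<omega> = \<bar>l * g (n + 1) \<omega> - g n \<omega>\<bar>"
  using rec[of "n + 2" \<omega>] by simp

lemma g_ge: "\<omega> \<in> space M \<Longrightarrow> 1 \<le> n \<Longrightarrow> l * g (n + 1) \<omega> - g n \<omega> \<le> g (n + 2) \<omega>"
  using g_plus[of \<omega> n] g_minus[of \<omega> n] g_nonneg[of \<omega> n] by (cases "coin (n + 2) \<omega>") auto

lemma g_measurable [measurable]: assumes "1 \<le> n" shows "g n \<in> borel_measurable M"
proof -
  have "(\<lambda>\<omega>. restrict (\<lambda>i. coin i \<omega>) {3..n}) \<in> measurable M (PiM {3..n} (\<lambda>_. count_space UNIV))"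
    using indep by (intro measurable_restrict) (auto simp: indep_vars_def)
  from measurable_compose[OF this fib_path_measurable[of n n l x y]]
  have "(\<lambda>\<omega>. fib_path l x y (restrict (\<lambda>i. coin i \<omega>) {3..n}) n) \<in> borel_measurable M"
    by simp
  then show ?thesis
    by (rule measurable_cong[THEN iffD1, rotated]) (use assms in \<open>simp add: g_eq_fib_path fib_path_restrict\<close>)
qed

text \<open>A crude bound by at most tripling at each step, which provides integrability.\<close>

lemma g_le: "\<omega> \<in> space M \<Longrightarrow> 1 \<le> n \<Longrightarrow> g n \<omega> \<le> (x + y) * 3 ^ n"
proof (induction n rule: less_induct)
  case (less n)
  show ?case
  proof (cases "n \<le> 2")
    case True
    then have "g n \<omega> \<le> x + y"
      using less.prems g_1 g_2 pos by (cases "n = 1") (auto simp: le_less_Suc_eq dest: le_antisym)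
    also have "\<dots> \<le> (x + y) * 3 ^ n"
      using pos by (simp add: one_le_power)
    finally show ?thesis .
  next
    case False
    then obtain k where k: "n = k + 2" "1 \<le> k"
      by (metis add.commute le_Suc_ex nat_le_linear not_less_eq_eq plus_1_eq_Suc numeral_2_eq_2 add_2_eq_Suc)
    have "g n \<omega> \<le> l * g (k + 1) \<omega> + g k \<omega>"
      using g_plus[of \<omega> k] g_minus[of \<omega> k] g_nonneg[of \<omega> k] g_nonneg[of \<omega> "k + 1"] less.prems k l
      by (cases "coin n \<omega>") (auto simp: abs_le_iff)
    also have "\<dots> \<le> 2 * ((x + y) * 3 ^ (k + 1)) + (x + y) * 3 ^ k"
      using less.IH[of k] less.IH[of "k + 1"] g_nonneg[of \<omega> "k + 1"] less.prems k l
      by (intro add_mono mult_mono) auto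
    also have "\<dots> \<le> (x + y) * 3 ^ n"
      using pos k by (simp add: field_simps)
    finally show ?thesis .
  qed
qed

lemma g_integrable [simp]: assumes "1 \<le> n" shows "integrable M (g n)"
  by (rule integrable_const_bound[where B = "(x + y) * 3 ^ n"])
    (use assms in \<open>auto simp: g_nonneg g_le\<close>)

lemma minus_block_integrable:
  assumes n: "1 \<le> n" and X: "integrable M X"
  shows "integrable M (\<lambda>\<omega>. minus_block n k \<omega> * X \<omega>)"
proof (rule Bochner_Integration.integrable_bound[OF X])
  have "{\<omega> \<in> space M. coin i \<omega>} \<in> sets M" if "3 \<le> i" for i
    using coin_measurable[OF that] by measurable
  then have "{\<omega> \<in> space M. \<forall>i\<in>{n + 2..n + 1 + k}. \<not> coin i \<omega>} \<in> sets M"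
    using n by (intro sets.sets_Collect_finite_All sets.sets_Collect_neg) auto
  then have "minus_block n k \<in> borel_measurable M"
    unfolding minus_block_def[abs_def] of_bool_def by (intro measurable_If) auto
  then show "(\<lambda>\<omega>. minus_block n k \<omega> * X \<omega>) \<in> borel_measurable M"
    using X by (intro borel_measurable_times) auto
qed (auto simp: minus_block_def)

text \<open>The pair \<open>g n\<close>, \<open>g (n + 1)\<close> is a function of the coins
  \<open>{3..n + 1}\<close>, while the block starts at \<open>n + 2\<close>; independence then
  splits off the probability of \<open>k\<close> fair coins all showing minus.\<close>

lemma expectation_minus_block:
  fixes h :: "real \<Rightarrow> real \<Rightarrow> real"
  assumes n: "1 \<le> n" and h: "case_prod h \<in> borel_measurable (borel \<Otimes>\<^sub>M borel)"
    and int: "integrable M (\<lambda>\<omega>. h (g n \<omega>) (g (n + 1) \<omega>))"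
  shows "expectation (\<lambda>\<omega>. minus_block n k \<omega> * h (g n \<omega>) (g (n + 1) \<omega>)) =
    (1 / 2) ^ k * expectation (\<lambda>\<omega>. h (g n \<omega>) (g (n + 1) \<omega>))"
proof -
  let ?\<phi> = "\<lambda>c. h (fib_path l x y c n) (fib_path l x y c (n + 1))"
  have eq: "h (g n \<omega>) (g (n + 1) \<omega>) = ?\<phi> (restrict (\<lambda>i. coin i \<omega>) {3..n + 1})" if "\<omega> \<in> space M" for \<omega>
    using that n fib_path_restrict[of n "n + 1"] fib_path_restrict[of "n + 1" "n + 1"]
    by (simp add: g_eq_fib_path)
  have half: "prob {\<omega> \<in> space M. \<not> coin i \<omega>} = 1 / 2" if "3 \<le> i" for i
  proof -
    note coin_measurable[OF that, measurable]
    have "{\<omega> \<in> space M. \<not> coin i \<omega>} = space M - {\<omega> \<in> space M. coin i \<omega>}"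
      by auto
    then show ?thesis
      using prob_compl[of "{\<omega> \<in> space M. coin i \<omega>}"] fair[OF that] by simp
  qed
  have meas: "?\<phi> \<in> borel_measurable (PiM {3..n + 1} (\<lambda>_. count_space UNIV))"
    using measurable_compose[OF measurable_Pair[OF fib_path_measurable fib_path_measurable] h,
        of n "n + 1" "n + 1" l x y l x y] by simp
  have int\<phi>: "integrable M (\<lambda>\<omega>. ?\<phi> (restrict (\<lambda>i. coin i \<omega>) {3..n + 1}))"
    by (rule Bochner_Integration.integrable_cong[THEN iffD1, OF refl _ int]) (rule eq)
  have "expectation (\<lambda>\<omega>. minus_block n k \<omega> * ?\<phi> (restrict (\<lambda>i. coin i \<omega>) {3..n + 1})) =
      (1 / 2) ^ card {n + 2..n + 1 + k} * expectation (\<lambda>\<omega>. ?\<phi> (restrict (\<lambda>i. coin i \<omega>) {3..n + 1}))"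
    unfolding minus_block_def
    by (rule expectation_coin_block[OF indep _ _ _ _ half meas int\<phi>]) (use n in auto)
  moreover have "expectation (\<lambda>\<omega>. ?\<phi> (restrict (\<lambda>i. coin i \<omega>) {3..n + 1})) = expectation (\<lambda>\<omega>. h (g n \<omega>) (g (n + 1) \<omega>))"
    by (rule Bochner_Integration.integral_cong) (simp_all only: eq)
  moreover have "expectation (\<lambda>\<omega>. minus_block n k \<omega> * ?\<phi> (restrict (\<lambda>i. coin i \<omega>) {3..n + 1})) =
      expectation (\<lambda>\<omega>. minus_block n k \<omega> * h (g n \<omega>) (g (n + 1) \<omega>))"
    by (rule Bochner_Integration.integral_cong) (simp_all only: eq)
  ultimately show ?thesis
    by simp
qed

section \<open>The recurrence for the expected values\<close>

text \<open>Positive exactly when the absolute value in the minus branch reflects a negative number,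
  that is when the recurrence stops being linear.\<close>

definition deficit :: "nat \<Rightarrow> 'a \<Rightarrow> real" where
  "deficit n \<omega> = max 0 (g n \<omega> - l * g (n + 1) \<omega>)"

lemma deficit_nonneg: "0 \<le> deficit n \<omega>"
  by (simp add: deficit_def)

lemma deficit_integrable [simp]: "1 \<le> n \<Longrightarrow> integrable M (deficit n)"
  unfolding deficit_def[abs_def] by (intro integrable_max) auto

lemma expectation_step:
  assumes n: "1 \<le> n"
  shows "expectation (g (n + 2)) = l * expectation (g (n + 1)) + expectation (deficit n)"
proof -
  \<comment> \<open>\<open>h\<close> is the change caused by a minus sign relative to a plus sign,
    so \<open>g (n + 2)\<close> is the plus value corrected by \<open>h\<close> on a block of length
    one.\<close>
  define h where "h u v = \<bar>l * v - u\<bar> - (l * v + u)" for u v :: real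
  have int: "integrable M (\<lambda>\<omega>. h (g n \<omega>) (g (n + 1) \<omega>))"
    unfolding h_def using n by (intro Bochner_Integration.integrable_diff integrable_abs) auto
  have split: "g (n + 2) \<omega> = (l * g (n + 1) \<omega> + g n \<omega>) + minus_block n 1 \<omega> * h (g n \<omega>) (g (n + 1) \<omega>)"
    if "\<omega> \<in> space M" for \<omega>
    using g_plus[OF that n] g_minus[OF that n] by (cases "coin (n + 2) \<omega>") (auto simp: h_def minus_block_def)
  note intA = minus_block_integrable[OF n int, of 1]
  have "expectation (g (n + 2)) =
      expectation (\<lambda>\<omega>. (l * g (n + 1) \<omega> + g n \<omega>) + minus_block n 1 \<omega> * h (g n \<omega>) (g (n + 1) \<omega>))"
    by (rule Bochner_Integration.integral_cong) (simp_all only: split)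
  also have "\<dots> = expectation (\<lambda>\<omega>. l * g (n + 1) \<omega> + g n \<omega>) + expectation (\<lambda>\<omega>. minus_block n 1 \<omega> * h (g n \<omega>) (g (n + 1) \<omega>))"
    using n intA by (intro Bochner_Integration.integral_add) auto
  also have "expectation (\<lambda>\<omega>. minus_block n 1 \<omega> * h (g n \<omega>) (g (n + 1) \<omega>)) = (1/2) ^ 1 * expectation (\<lambda>\<omega>. h (g n \<omega>) (g (n + 1) \<omega>))"
    by (rule expectation_minus_block[OF n _ int]) (simp add: h_def case_prod_unfold)
  also have "expectation (\<lambda>\<omega>. l * g (n + 1) \<omega> + g n \<omega>) + \<dots> =
      expectation (\<lambda>\<omega>. (l * g (n + 1) \<omega> + g n \<omega>) + 1/2 * h (g n \<omega>) (g (n + 1) \<omega>))"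
    using n int by (subst Bochner_Integration.integral_add) auto
  also have "\<dots> = expectation (\<lambda>\<omega>. l * g (n + 1) \<omega> + deficit n \<omega>)"
    by (rule Bochner_Integration.integral_cong) (auto simp: h_def deficit_def max_def field_simps)
  also have "\<dots> = l * expectation (g (n + 1)) + expectation (deficit n)"
    using n by (subst Bochner_Integration.integral_add) auto
  finally show ?thesis .
qed

lemma expectation_ge:
  assumes "2 \<le> n"
  shows "l * expectation (g n) \<le> expectation (g (Suc n))"
proof -
  from assms obtain m where m: "n = m + 1" "1 \<le> m"
    by (metis One_nat_def Suc_eq_plus1 Suc_le_D Suc_le_mono numeral_2_eq_2)
  show ?thesis
    using expectation_step[OF m(2)] m(1) Bochner_Integration.integral_nonneg[of M "deficit m"]
    by (simp add: deficit_nonneg)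
qed

lemma expectation_power_ge:
  assumes "2 \<le> n"
  shows "l ^ k * expectation (g n) \<le> expectation (g (n + k))"
proof (induction k)
  case (Suc k)
  have "l ^ Suc k * expectation (g n) = l * (l ^ k * expectation (g n))"
    by simp
  also have "\<dots> \<le> l * expectation (g (n + k))"
    using Suc l by (intro mult_left_mono) auto
  also have "\<dots> \<le> expectation (g (n + Suc k))"
    using expectation_ge[of "n + k"] assms by simp
  finally show ?case .
qed simp

lemma expectation_nonneg: "1 \<le> n \<Longrightarrow> 0 \<le> expectation (g n)"
  by (rule Bochner_Integration.integral_nonneg) (auto simp: g_nonneg)

lemma expectation_pos:
  assumes "2 \<le> n"
  shows "0 < expectation (g n)"
proof -
  have "expectation (g 2) = expectation (\<lambda>_. y)"
    by (rule Bochner_Integration.integral_cong) (auto simp: g_2)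
  then have "expectation (g 2) = y"
    by (simp add: prob_space)
  then have "0 < l ^ (n - 2) * expectation (g 2)"
    using pos l by simp
  also have "\<dots> \<le> expectation (g n)"
    using expectation_power_ge[of 2 "n - 2"] assms by (simp del: add_2_eq_Suc)
  finally show ?thesis .
qed

section \<open>Upper bound on the growth rate\<close>

text \<open>
  With \<open>l = 2 cos \<theta>\<close> the sharp bound on the ratio is \<open>sin ((i + 1) \<theta>) / sin (i \<theta>)\<close>; the rational
  expression below is a lower bound for it that is still at least 1 for \<open>i\<close> up to \<open>1 / sqrt (2 - l)\<close>.
\<close>

lemma ratio_after_plus:
  assumes "\<omega> \<in> space M" "1 \<le> n" "coin (n + 2) \<omega>" "1 \<le> i" "real i ^ 2 * (2 - l) \<le> 1"
  shows "(1 + 1 / real i - real i * (2 - l)) * g (n + i) \<omega> \<le> g (n + i + 1) \<omega>"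
  using assms(4,5)
proof (induction i rule: dec_induct)
  \<comment> \<open>For \<open>i = 1\<close> the factor is \<open>1 + 1 - (2 - l) = l\<close>, the
    ratio that a plus sign guarantees.\<close>
  case base
  then show ?case
    using g_plus[of \<omega> n] g_nonneg[of \<omega> n] assms by simp
next
  case (step i)
  define d where "d = 2 - l"
  define t where "t = real i"
  define r where "r = 1 + 1 / t - t * d"
  have t: "1 \<le> t" and d: "0 \<le> d"
    using step l by (auto simp: t_def d_def)
  have "t\<^sup>2 * d \<le> (real (Suc i))\<^sup>2 * d"
    using d by (intro mult_right_mono power_mono) (auto simp: t_def)
  then have td: "t\<^sup>2 * d \<le> 1"
    using step.prems by (simp add: d_def)
  then have IH: "r * g (n + i) \<omega> \<le> g (n + i + 1) \<omega>"
    using step.IH by (simp add: r_def t_def d_def)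
  have "t * d \<le> 1 / t"
    using td t by (simp add: field_simps power2_eq_square)
  then have r: "1 \<le> r"
    by (simp add: r_def)
  \<comment> \<open>A minus sign turns the ratio \<open>r\<close> into \<open>l - 1 / r\<close>.
    That this is at least the next factor, with \<open>t + 1\<close> for \<open>t\<close>,
    rearranges to the inequality here; the surplus is nonnegative because
    \<open>t\<^sup>2 * d \<le> 1\<close>.\<close>
  have "1 \<le> r * (t / (t + 1) + t * d)"
  proof -
    have "r * (t / (t + 1) + t * d) - 1 = d * ((2 * t + 1) / (t + 1) - t\<^sup>2 * d)"
      unfolding r_def using t by (simp add: divide_simps) (simp add: algebra_simps power2_eq_square)
    moreover have "1 \<le> (2 * t + 1) / (t + 1)"
      using t by simp
    ultimately show ?thesis
      using td d by (smt (verit) mult_nonneg_nonneg)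
  qed
  then have "1 / r \<le> t / (t + 1) + t * d"
    using r by (simp add: field_simps)
  moreover have "t / (t + 1) = 1 - 1 / (t + 1)"
    using t by (simp add: field_simps)
  ultimately have le: "1 + 1 / (t + 1) - (t + 1) * d \<le> l - 1 / r"
    by (simp add: d_def algebra_simps)
  have "g (n + i) \<omega> \<le> g (n + i + 1) \<omega> / r"
    using IH r by (simp add: field_simps)
  then have "(l - 1 / r) * g (n + i + 1) \<omega> \<le> g (n + i + 2) \<omega>"
    using g_ge[of \<omega> "n + i"] assms by (simp add: algebra_simps)
  moreover have "(1 + 1 / (t + 1) - (t + 1) * d) * g (n + i + 1) \<omega> \<le> (l - 1 / r) * g (n + i + 1) \<omega>"
    using le g_nonneg assms by (intro mult_right_mono) auto
  ultimately show ?case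
    by (simp add: t_def d_def add.commute)
qed

text \<open>For such \<open>i\<close> the factor in \<open>ratio_after_plus\<close> is at least 1,
  so the sequence does not decrease at this step and \<open>l \<ge> 1\<close> leaves no positive
  part.\<close>

lemma deficit_zero_after_plus:
  assumes "\<omega> \<in> space M" "1 \<le> n" "coin (n + 2) \<omega>" "1 \<le> i" "real i ^ 2 * (2 - l) \<le> 1"
  shows "deficit (n + i) \<omega> = 0"
proof -
  have "real i * (2 - l) \<le> 1 / real i"
    using assms(4,5) by (simp add: field_simps power2_eq_square)
  then have "1 * g (n + i) \<omega> \<le> (1 + 1 / real i - real i * (2 - l)) * g (n + i) \<omega>"
    using g_nonneg assms by (intro mult_right_mono) auto
  also have "\<dots> \<le> 1 * g (n + i + 1) \<omega>"
    using ratio_after_plus[OF assms] by simp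
  also have "\<dots> \<le> l * g (n + i + 1) \<omega>"
    using g_nonneg assms l by (intro mult_right_mono) auto
  finally show ?thesis
    by (simp add: deficit_def)
qed

text \<open>For nonnegative \<open>u\<close> and \<open>v\<close> the value
  \<open>\<bar>l * v - u\<bar>\<close> is at most the larger of \<open>2 * v\<close> and
  \<open>u\<close>, so a common bound on two neighbours at most doubles. The resulting
  \<open>2 ^ k\<close> is exactly what the probability of the block cancels.\<close>

lemma minus_block_le:
  assumes "\<omega> \<in> space M" "1 \<le> n" "\<forall>i\<in>{n + 2..n + 1 + k}. \<not> coin i \<omega>"
  shows "g (n + k) \<omega> \<le> 2 ^ k * (g n \<omega> + g (n + 1) \<omega>) \<and>
    g (n + k + 1) \<omega> \<le> 2 ^ k * (g n \<omega> + g (n + 1) \<omega>)"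
  using assms(3)
proof (induction k)
  case 0
  then show ?case
    using g_nonneg[of \<omega> n] g_nonneg[of \<omega> "n + 1"] assms by simp
next
  case (Suc k)
  have nn: "0 \<le> g (n + k) \<omega>" "0 \<le> g (n + k + 1) \<omega>"
    using g_nonneg assms by auto
  have lv: "l * g (n + k + 1) \<omega> \<le> 2 * g (n + k + 1) \<omega>" "0 \<le> l * g (n + k + 1) \<omega>"
    using l nn by (auto intro: mult_right_mono)
  have "g (n + k + 2) \<omega> = \<bar>l * g (n + k + 1) \<omega> - g (n + k) \<omega>\<bar>"
    using g_minus[of \<omega> "n + k"] Suc.prems assms by simp
  moreover have "g (n + k) \<omega> \<le> 2 ^ k * (g n \<omega> + g (n + 1) \<omega>)"
    "g (n + k + 1) \<omega> \<le> 2 ^ k * (g n \<omega> + g (n + 1) \<omega>)"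
    using Suc by auto
  ultimately have "g (n + k + 2) \<omega> \<le> 2 * (2 ^ k * (g n \<omega> + g (n + 1) \<omega>))"
    "g (n + k + 1) \<omega> \<le> 2 * (2 ^ k * (g n \<omega> + g (n + 1) \<omega>))"
    using lv nn by linarith+
  then show ?case
    by simp
qed

text \<open>If one of the last \<open>k\<close> coins before the deficit is a plus, the deficit
  vanishes. Otherwise it is at most \<open>g (n + k)\<close>, which is controlled by
  \<open>2 ^ k\<close> on an event of probability \<open>(1 / 2) ^ k\<close>.\<close>

lemma expectation_deficit_le:
  assumes n: "1 \<le> n" and k: "real k ^ 2 * (2 - l) \<le> 1"
  shows "expectation (deficit (n + k)) \<le> expectation (g n) + expectation (g (n + 1))"
proof -
  have le: "deficit (n + k) \<omega> \<le> 2 ^ k * (minus_block n k \<omega> * (g n \<omega> + g (n + 1) \<omega>))" if w: "\<omega> \<in> space M" for \<omega>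
  proof (cases "\<forall>i\<in>{n + 2..n + 1 + k}. \<not> coin i \<omega>")
    case True
    have "deficit (n + k) \<omega> \<le> g (n + k) \<omega>"
      using l n g_nonneg[OF w, of "n + k"] g_nonneg[OF w, of "n + k + 1"] by (simp add: deficit_def)
    then show ?thesis
      using True minus_block_le[OF w n True] by (simp add: minus_block_def)
  next
    case False
    then obtain j where j: "n + 2 \<le> j" "j \<le> n + 1 + k" "coin j \<omega>"
      by auto
    \<comment> \<open>The shift by 2 makes \<open>j\<close> the coin \<open>m + 2\<close> of
      \<open>deficit_zero_after_plus\<close>; the range of \<open>j\<close> gives
      \<open>1 \<le> i \<le> k\<close>.\<close>
    define m where "m = j - 2"
    define i where "i = n + k - m"
    have mi: "1 \<le> m" "coin (m + 2) \<omega>" "1 \<le> i" "i \<le> k" "m + i = n + k"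
      using j n le_add_diff_inverse2[of 2 j] by (auto simp: m_def i_def simp del: add_2_eq_Suc')
    have "(real i)\<^sup>2 * (2 - l) \<le> (real k)\<^sup>2 * (2 - l)"
      using mi l by (intro mult_right_mono power_mono) auto
    then have "deficit (m + i) \<omega> = 0"
      using deficit_zero_after_plus[OF w mi(1-3)] k by simp
    moreover have "minus_block n k \<omega> = 0"
      using False by (simp only: minus_block_def of_bool_eq simp_thms)
    ultimately show ?thesis
      using mi by simp
  qed
  have int: "integrable M (\<lambda>\<omega>. minus_block n k \<omega> * (g n \<omega> + g (n + 1) \<omega>))"
    using n by (intro minus_block_integrable) auto
  have "expectation (deficit (n + k)) \<le> expectation (\<lambda>\<omega>. 2 ^ k * (minus_block n k \<omega> * (g n \<omega> + g (n + 1) \<omega>)))"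
    using n int le by (intro integral_mono) auto
  also have "\<dots> = 2 ^ k * ((1 / 2) ^ k * expectation (\<lambda>\<omega>. g n \<omega> + g (n + 1) \<omega>))"
    using n expectation_minus_block[OF n, of "(+)" k] by (simp add: case_prod_unfold)
  also have "\<dots> = expectation (g n) + expectation (g (n + 1))"
    using n by (simp add: power_one_over)
  finally show ?thesis .
qed

text \<open>The deficit entering step \<open>N\<close> is bounded by two expected values about
  \<open>k\<close> steps earlier. Expected values grow at least by the factor \<open>l\<close> per
  step, so each of the two is at most \<open>l ^ k\<close> times smaller than needed: at most
  \<open>expectation (g N) / l ^ k\<close>.\<close>

lemma growth_rate_upper:
  assumes lim: "(\<lambda>n. root n (expectation (g n))) \<longlonglongrightarrow> G"
    and k: "real k ^ 2 * (2 - l) \<le> 1"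
  shows "G \<le> l + 2 / l ^ k"
proof (rule growth_rate_le[OF lim])
  show "0 < l + 2 / l ^ k" "0 < expectation (g (k + 3))"
    using l by (auto intro!: add_pos_pos expectation_pos)
  fix N assume "k + 3 \<le> N"
  then obtain n where n: "N = n + k + 1" "2 \<le> n"
    by (intro that[of "N - k - 1"]) auto
  have "l ^ k * expectation (g (n + 1)) \<le> expectation (g N)"
    using expectation_power_ge[of "n + 1" k] n by (simp add: add_ac)
  then have 1: "expectation (g (n + 1)) \<le> expectation (g N) / l ^ k"
    using l by (simp add: field_simps)
  have "1 * expectation (g n) \<le> l * expectation (g n)"
    using l expectation_nonneg n by (intro mult_right_mono) auto
  then have 2: "expectation (g n) \<le> expectation (g (n + 1))"
    using expectation_ge[of n] n by simp
  have "expectation (g (Suc N)) = l * expectation (g N) + expectation (deficit (n + k))"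
    using expectation_step[of "n + k"] n by simp
  then show "expectation (g (Suc N)) \<le> (l + 2 / l ^ k) * expectation (g N)"
    using 1 2 expectation_deficit_le[of n, OF _ k] n by (simp add: algebra_simps)
qed

section \<open>Strict lower bound on the growth rate\<close>

text \<open>
  Multiplying the linear recurrence with error \<open>2 * deficit\<close> by \<open>sin (j \<theta>)\<close> makes the sum telescope.
\<close>

lemma minus_block_deficit_sum:
  assumes "\<omega> \<in> space M" "1 \<le> n" "\<forall>i\<in>{n + 2..n + 1 + N}. \<not> coin i \<omega>" and theta: "l = 2 * cos \<theta>"
  shows "(\<Sum>j<N. 2 * sin (real (j + 1) * \<theta>) * deficit (n + j) \<omega>) =
    sin \<theta> * g n \<omega> + sin (real N * \<theta>) * g (n + N + 1) \<omega> - sin (real (N + 1) * \<theta>) * g (n + N) \<omega>"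
  using assms(3)
proof (induction N)
  case (Suc N)
  have "g (n + N + 2) \<omega> = \<bar>l * g (n + N + 1) \<omega> - g (n + N) \<omega>\<bar>"
    using g_minus[of \<omega> "n + N"] Suc.prems assms by simp
  \<comment> \<open>With \<open>z = l * g (n + N + 1) - g (n + N)\<close> the deficit is the
    negative part of \<open>z\<close>, and \<open>\<bar>z\<bar> - z\<close> is twice that
    part.\<close>
  then have 1: "2 * deficit (n + N) \<omega> = g (n + N + 2) \<omega> - l * g (n + N + 1) \<omega> + g (n + N) \<omega>"
    by (simp add: deficit_def max_def abs_if)
  have 2: "sin (real (N + 2) * \<theta>) = l * sin (real (N + 1) * \<theta>) - sin (real N * \<theta>)"
  proof -
    have "real (N + 2) * \<theta> = real (N + 1) * \<theta> + \<theta>" "real N * \<theta> = real (N + 1) * \<theta> - \<theta>"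
      by (simp_all add: algebra_simps)
    then show ?thesis
      unfolding theta by (simp only: sin_add sin_diff) simp
  qed
  have "(\<Sum>j<Suc N. 2 * sin (real (j + 1) * \<theta>) * deficit (n + j) \<omega>) =
      (sin \<theta> * g n \<omega> + sin (real N * \<theta>) * g (n + N + 1) \<omega> - sin (real (N + 1) * \<theta>) * g (n + N) \<omega>)
      + sin (real (N + 1) * \<theta>) * (2 * deficit (n + N) \<omega>)"
    using Suc by (simp add: mult_ac)
  also have "\<dots> = sin \<theta> * g n \<omega> + sin (real (N + 1) * \<theta>) * g (n + N + 2) \<omega> - sin (real (N + 2) * \<theta>) * g (n + N + 1) \<omega>"
    unfolding 1 2 by (simp add: algebra_simps)
  finally show ?case
    by (simp add: add_ac)
qed simp

end

text \<open>\<open>N\<close> counts the steps of size \<open>\<theta>\<close> that fit into a half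
  turn; since \<open>\<theta> < pi\<close>, one more step lands between \<open>pi\<close> and
  \<open>2 * pi\<close>.\<close>

lemma sine_sign_change:
  assumes "0 < \<theta>" "\<theta> < pi"
  obtains N :: nat where "\<And>j. j \<le> N \<Longrightarrow> 0 \<le> sin (real j * \<theta>)" "sin (real (N + 1) * \<theta>) \<le> 0"
proof -
  define N where "N = nat \<lfloor>pi / \<theta>\<rfloor>"
  have "real N \<le> pi / \<theta>" "pi / \<theta> < real N + 1"
    using assms by (auto simp: N_def)
  then have N: "real N * \<theta> \<le> pi" "pi \<le> real (N + 1) * \<theta>"
    using assms by (simp_all add: field_simps)
  show ?thesis
  proof (rule that[of N])
    show "0 \<le> sin (real j * \<theta>)" if "j \<le> N" for j
    proof (rule sin_ge_zero)
      have "real j * \<theta> \<le> real N * \<theta>"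
        using that assms by (intro mult_right_mono) auto
      then show "real j * \<theta> \<le> pi"
        using N by simp
    qed (use assms in simp)
    show "sin (real (N + 1) * \<theta>) \<le> 0"
    proof (rule sin_le_zero)
      have "real (N + 1) * \<theta> = real N * \<theta> + \<theta>"
        by (simp add: algebra_simps)
      then show "real (N + 1) * \<theta> < 2 * pi"
        using N assms by simp
    qed (use N in simp)
  qed
qed

context fair_random_fibonacci
begin

text \<open>On a run of \<open>N\<close> minus signs the telescoped sum keeps
  \<open>sin \<theta> * g n\<close> plus two end terms, which the sign change of the sine makes
  nonnegative. So the run forces a deficit proportional to \<open>g n\<close>, and it has positive
  probability.\<close>

lemma deficit_sum_ge:
  assumes "l < 2"
  obtains N c where "0 < c" "\<And>n. 1 \<le> n \<Longrightarrow> c * expectation (g n) \<le> (\<Sum>j<N. expectation (deficit (n + j)))"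
proof -
  define \<theta> where "\<theta> = arccos (l / 2)"
  have cos: "l = 2 * cos \<theta>"
    using l by (simp add: \<theta>_def cos_arccos)
  have \<theta>: "0 < \<theta>" "\<theta> < pi"
    using arccos_lt_bounded[of "l / 2"] l assms by (auto simp: \<theta>_def)
  obtain N :: nat
    where N: "\<And>j. j \<le> N \<Longrightarrow> 0 \<le> sin (real j * \<theta>)" "sin (real (N + 1) * \<theta>) \<le> 0"
    using sine_sign_change[OF \<theta>] by blast
  have s: "0 < sin \<theta>"
    using \<theta> by (simp add: sin_gt_zero)
  have ge: "minus_block n N \<omega> * (sin \<theta> / 2 * g n \<omega>) \<le> (\<Sum>j<N. deficit (n + j) \<omega>)"
    if w: "\<omega> \<in> space M" and n: "1 \<le> n" for n \<omega>
  proof (cases "\<forall>i\<in>{n + 2..n + 1 + N}. \<not> coin i \<omega>")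
    case True
    have "sin (real N * \<theta>) * g (n + N + 1) \<omega> \<ge> 0" "sin (real (N + 1) * \<theta>) * g (n + N) \<omega> \<le> 0"
      using N(1)[of N] N(2) g_nonneg[OF w] n by (auto intro: mult_nonpos_nonneg)
    then have "sin \<theta> * g n \<omega> \<le> (\<Sum>j<N. 2 * sin (real (j + 1) * \<theta>) * deficit (n + j) \<omega>)"
      unfolding minus_block_deficit_sum[OF w n True cos] by linarith
    \<comment> \<open>Deficits are nonnegative, so raising the sine weights to 1 only enlarges the
      sum.\<close>
    also have "\<dots> \<le> (\<Sum>j<N. 2 * 1 * deficit (n + j) \<omega>)"
      by (intro sum_mono mult_right_mono mult_left_mono) (auto simp: deficit_nonneg)
    finally show ?thesis
      using True by (simp add: minus_block_def sum_distrib_left[symmetric])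
  next
    case False
    then have "minus_block n N \<omega> = 0"
      by (simp only: minus_block_def of_bool_eq simp_thms)
    then show ?thesis
      by (simp add: deficit_nonneg sum_nonneg)
  qed
  show ?thesis
  \<comment> \<open>The constant is the probability of the run times the share
    \<open>sin \<theta> / 2\<close> of \<open>g n\<close> it yields.\<close>
  proof (rule that[of "(1 / 2) ^ N * (sin \<theta> / 2)" N])
    show "0 < (1 / 2) ^ N * (sin \<theta> / 2)"
      using s by simp
    fix n :: nat
    assume n: "1 \<le> n"
    have "(1 / 2) ^ N * (sin \<theta> / 2) * expectation (g n) = (1 / 2) ^ N * expectation (\<lambda>\<omega>. sin \<theta> / 2 * g n \<omega>)"
      by simp
    also have "\<dots> = expectation (\<lambda>\<omega>. minus_block n N \<omega> * (sin \<theta> / 2 * g n \<omega>))"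
      using n expectation_minus_block[OF n, of "\<lambda>u v. sin \<theta> / 2 * u" N] by (simp add: case_prod_unfold)
    also have "\<dots> \<le> expectation (\<lambda>\<omega>. \<Sum>j<N. deficit (n + j) \<omega>)"
      using n ge by (intro integral_mono minus_block_integrable) auto
    also have "\<dots> = (\<Sum>j<N. expectation (deficit (n + j)))"
      using n by (intro Bochner_Integration.integral_sum) auto
    finally show "(1 / 2) ^ N * (sin \<theta> / 2) * expectation (g n) \<le> \<dots>" .
  qed
qed

text \<open>Over \<open>N + 1\<close> steps the expected value gains at least the factor
  \<open>l ^ (N + 1) + c\<close>, whose root of order \<open>N + 1\<close> exceeds
  \<open>l\<close>.\<close>

lemma growth_rate_lower:
  assumes lim: "(\<lambda>n. root n (expectation (g n))) \<longlonglongrightarrow> G" and "l < 2"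
  shows "l < G"
proof -
  obtain N c where c: "0 < c"
    "\<And>n. 1 \<le> n \<Longrightarrow> c * expectation (g n) \<le> (\<Sum>j<N. expectation (deficit (n + j)))"
    using deficit_sum_ge[OF \<open>l < 2\<close>] by blast
  \<comment> \<open>Iterates \<open>expectation_step\<close>, discarding the powers of
    \<open>l \<ge> 1\<close> that multiply the earlier deficits.\<close>
  have acc: "l ^ k * expectation (g (n + 1)) + (\<Sum>j<k. expectation (deficit (n + j))) \<le> expectation (g (n + k + 1))"
    if n: "1 \<le> n" for n k
  proof (induction k)
    case (Suc k)
    have "(\<Sum>j<k. expectation (deficit (n + j))) \<le> l * (\<Sum>j<k. expectation (deficit (n + j)))"
      using l mult_right_mono[of 1 l "\<Sum>j<k. expectation (deficit (n + j))"]
      by (simp add: sum_nonneg Bochner_Integration.integral_nonneg deficit_nonneg)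
    moreover have "l * (l ^ k * expectation (g (n + 1)) + (\<Sum>j<k. expectation (deficit (n + j)))) \<le> l * expectation (g (n + k + 1))"
      using Suc l by (intro mult_left_mono) auto
    ultimately show ?case
      using expectation_step[of "n + k"] n by (simp add: algebra_simps)
  qed simp
  have "root (N + 1) (l ^ (N + 1) + c) \<le> G"
  proof (rule growth_rate_ge[OF lim, of _ _ 2])
    show "0 < l ^ (N + 1) + c"
      using l c by (intro add_pos_pos) auto
    fix n :: nat
    assume n: "2 \<le> n"
    have "l ^ N * (l * expectation (g n)) \<le> l ^ N * expectation (g (n + 1))"
      using expectation_ge[OF n] l by (intro mult_left_mono) auto
    then show "(l ^ (N + 1) + c) * expectation (g n) \<le> expectation (g (n + (N + 1)))"
      using acc[of n N] c(2)[of n] n by (simp add: algebra_simps)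
  qed (auto intro: expectation_pos)
  moreover have "root (N + 1) (l ^ (N + 1)) < root (N + 1) (l ^ (N + 1) + c)"
    using c by (intro real_root_less_mono) auto
  moreover have "root (N + 1) (l ^ (N + 1)) = l"
    using l by (intro real_root_power_cancel) auto
  ultimately show ?thesis
    by linarith
qed

end

section \<open>Bounds near 2 and the behaviour of the growth rate there\<close>

lemma random_fibonacci_imp_fair:
  assumes "random_fibonacci M (1 / 2) l g" "1 \<le> l" "l \<le> 2"
  obtains coin x y where "fair_random_fibonacci M l g coin x y"
proof -
  from assms(1) obtain x y coin where M: "prob_space M"
    and xy: "0 < x" "\<forall>\<omega>\<in>space M. g 1 \<omega> = x" "0 < y" "\<forall>\<omega>\<in>space M. g 2 \<omega> = y"
    and coin: "prob_space.indep_vars M (\<lambda>_. count_space UNIV) coin {3..}"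
      "\<forall>n\<ge>3. measure M {\<omega> \<in> space M. coin n \<omega>} = 1 / 2"
      "\<forall>n\<ge>3. \<forall>\<omega>\<in>space M.
         g n \<omega> = (if coin n \<omega> then \<bar>l * g (n - 1) \<omega> + g (n - 2) \<omega>\<bar>
                          else \<bar>l * g (n - 1) \<omega> - g (n - 2) \<omega>\<bar>)"
    unfolding random_fibonacci_def by blast
  have "fair_random_fibonacci_axioms M l g coin x y"
    using assms(2,3) xy coin by (intro fair_random_fibonacci_axioms.intro) blast+
  with M show ?thesis
    using that fair_random_fibonacci.intro by blast
qed

lemma growth_rate_bounds:
  assumes "random_fibonacci M (1 / 2) l g" "expectation_growth_rate M g G" "3 / 2 \<le> l"
  shows growth_rate_gt: "l < 2 \<Longrightarrow> l < G"
    and growth_rate_flat: "l < 2 \<Longrightarrow> G \<le> l + 3 * (2 / 3) powr (1 / sqrt (2 - l))"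
    and growth_rate_two: "l = 2 \<Longrightarrow> G = 2"
proof -
  have lim: "(\<lambda>n. root n (prob_space.expectation M (g n))) \<longlonglongrightarrow> G"
    using assms(2) by (simp add: expectation_growth_rate_def)
  {
    assume "l < 2"
    then obtain coin x y where "fair_random_fibonacci M l g coin x y"
      using random_fibonacci_imp_fair[OF assms(1)] assms(3) by auto
    then interpret fair_random_fibonacci M l g coin x y .
    show "l < G"
      by (rule growth_rate_lower[OF lim \<open>l < 2\<close>])
    define s where "s = 1 / sqrt (2 - l)"
    \<comment> \<open>The largest \<open>k\<close> with \<open>k ^ 2 * (2 - l) \<le> 1\<close>,
      hence the best choice in \<open>growth_rate_upper\<close>.\<close>
    define k where "k = nat \<lfloor>s\<rfloor>"
    have s: "0 < s" "s\<^sup>2 * (2 - l) = 1"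
      using \<open>l < 2\<close> by (auto simp: s_def power_divide)
    have k: "real k \<le> s" "s - 1 < real k"
      using s by (auto simp: k_def)
    have "(real k)\<^sup>2 * (2 - l) \<le> s\<^sup>2 * (2 - l)"
      using k s \<open>l < 2\<close> by (intro mult_right_mono power_mono) auto
    then have "G \<le> l + 2 / l ^ k"
      using growth_rate_upper[OF lim, of k] s by simp
    also have "2 / l ^ k \<le> 2 / (3 / 2) ^ k"
      using assms(3) by (intro divide_left_mono power_mono mult_pos_pos) auto
    also have "\<dots> = 2 * (2 / 3) powr real k"
      by (simp add: powr_realpow power_divide)
    \<comment> \<open>Rounding down loses less than 1 in the exponent, which costs a factor 3/2 and
      turns the constant 2 into 3.\<close>
    also have "\<dots> \<le> 2 * (2 / 3) powr (s - 1)"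
      using k by (intro mult_left_mono powr_mono') auto
    also have "\<dots> = 3 * (2 / 3) powr s"
      by (simp add: powr_diff)
    finally show "G \<le> l + 3 * (2 / 3) powr (1 / sqrt (2 - l))"
      by (simp add: s_def)
  }
  assume l2: "l = 2"
  then obtain coin x y where "fair_random_fibonacci M l g coin x y"
    using random_fibonacci_imp_fair[OF assms(1)] assms(3) by auto
  then interpret fair_random_fibonacci M l g coin x y .
  have "root 1 l \<le> G"
    using l expectation_ge expectation_pos by (intro growth_rate_ge[OF lim, of _ _ 2]) auto
  \<comment> \<open>At \<open>l = 2\<close> the condition on \<open>k\<close> holds for every
    \<open>k\<close>, so the error term can be sent to 0.\<close>
  moreover have "G \<le> 2"
  proof (rule LIMSEQ_le_const)
    show "(\<lambda>k. 2 + 2 / 2 ^ k :: real) \<longlonglongrightarrow> 2"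
      by real_asymp
    show "\<exists>K. \<forall>k\<ge>K. G \<le> 2 + 2 / 2 ^ k"
      using growth_rate_upper[OF lim] l2 by simp
  qed
  ultimately show "G = 2"
    using l2 by simp
qed

theorem corollary2:
  fixes a :: real
    and M :: "real \<Rightarrow> 'a measure"
    and g :: "real \<Rightarrow> nat \<Rightarrow> 'a \<Rightarrow> real"
    and G :: "real \<Rightarrow> real"
  assumes "a < 2"
    and "\<And>l. a < l \<Longrightarrow> l \<le> 2 \<Longrightarrow> random_fibonacci (M l) (1 / 2) l (g l)"
    and "\<And>l. a < l \<Longrightarrow> l \<le> 2 \<Longrightarrow> expectation_growth_rate (M l) (g l) (G l)"
    and "\<And>l. a < l \<Longrightarrow> l \<le> 2 \<Longrightarrow> G l > 1"
  shows "(G differentiable (at 2 within {..2}) \<longrightarrow>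
            (G has_real_derivative 1) (at 2 within {..2})) \<and>
         (\<forall>n. class_C_at_within n G 2 {..2} \<longrightarrow>
            (\<forall>i\<in>{2..n}. nth_deriv_within {..2} i G 2 = 0)) \<and>
         \<not> real_analytic_at_within G 2 {..2}"
proof -
  have lo: "l < G l" if "a < l" "3 / 2 \<le> l" "l < 2" for l
    using growth_rate_gt[OF assms(2,3)] that by simp
  have up: "G l \<le> l + 3 * (2 / 3) powr (1 / sqrt (2 - l))" if "a < l" "3 / 2 \<le> l" "l < 2" for l
    using growth_rate_flat[OF assms(2,3)] that by simp
  have two: "G 2 = 2"
    using growth_rate_two[OF assms(2,3)] \<open>a < 2\<close> by simp
  have near: "\<forall>\<^sub>F l in at_left 2. max a (3 / 2) < l \<and> l < 2"
    using \<open>a < 2\<close> by (intro eventually_at_leftI[of "max a (3 / 2)"]) auto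
  have flat: "((\<lambda>l. (G l - l) / (l - 2) ^ i) \<longlongrightarrow> 0) (at_left 2)" for i
  proof (rule Lim_null_comparison)
    \<comment> \<open>An exponential in \<open>- 1 / sqrt (2 - l)\<close> decays faster than every
      power of \<open>2 - l\<close>.\<close>
    show "((\<lambda>l::real. 3 * (2 / 3) powr (1 / sqrt (2 - l)) / (2 - l) ^ i) \<longlongrightarrow> 0) (at_left 2)"
      by real_asymp
    show "\<forall>\<^sub>F l in at_left 2. norm ((G l - l) / (l - 2) ^ i) \<le> 3 * (2 / 3) powr (1 / sqrt (2 - l)) / (2 - l) ^ i"
      using near
    proof eventually_elim
      case (elim l)
      then have "norm ((G l - l) / (l - 2) ^ i) = (G l - l) / (2 - l) ^ i"
        using lo[of l] elim by (simp add: abs_divide power_abs)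
      also have "\<dots> \<le> 3 * (2 / 3) powr (1 / sqrt (2 - l)) / (2 - l) ^ i"
        using up[of l] elim by (intro divide_right_mono) auto
      finally show ?case .
    qed
  qed
  have "(G has_real_derivative 1) (at 2 within {..2})"
  proof -
    \<comment> \<open>Since \<open>G 2 = 2\<close>, the difference quotient is 1 plus the flat
      quotient of order 1.\<close>
    have "((\<lambda>l. 1 + (G l - l) / (l - 2) ^ 1) \<longlongrightarrow> 1 + 0) (at_left 2)"
      by (intro tendsto_add tendsto_const flat)
    moreover have "\<forall>\<^sub>F l in at_left 2. 1 + (G l - l) / (l - 2) ^ 1 = (G l - G 2) / (l - 2)"
      using near by eventually_elim (auto simp: two field_simps)
    ultimately have "((\<lambda>l. (G l - G 2) / (l - 2)) \<longlongrightarrow> 1) (at_left 2)"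
      using tendsto_cong by fastforce
    then show ?thesis
      by (simp add: has_field_derivative_iff at_within_atMost_eq_at_left)
  qed
  moreover have "\<not> real_analytic_at_within G 2 {..2}"
  proof
    assume "real_analytic_at_within G 2 {..2}"
    \<comment> \<open>Analyticity would make \<open>G\<close> the identity just left of 2, where
      \<open>lo\<close> makes it strictly larger.\<close>
    from eventually_conj[OF near flat_analytic_eq[OF flat this]]
    have "\<forall>\<^sub>F l in at_left (2::real). False"
      by eventually_elim (use lo in fastforce)
    then show False
      by simp
  qed
  ultimately show ?thesis
    using nth_deriv_flat_zero[OF flat] by auto
qed

end
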